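(* Assume the framework described in the context ($L$ a vocabulary with approximations for the class $\mathcal K$, $\mathcal I$ an isomorphism notion of $\mathcal K$, and $L$ good for $(\mathcal K,\mathcal I)$). Let $\mathcal A,\mathcal B\in\mathcal K$ be separable and let $\varepsilon\in D$, $\varepsilon\geq 0$. Then player II has a winning strategy in the game $\mathrm{EF}^{\omega,\varepsilon}(\mathcal A,\mathcal B)$ (played between the whole structures $\mathcal A$ and $\mathcal B$) if and only if there exists an $\varepsilon$-isomorphism $\mathcal A\to\mathcal B$.
   Context: Fix a vocabulary $L$ and a class $\mathcal K$ of $L$-structures; $\Phi$ is the set of atomic $L$-formulas $R(t_1,\dots,t_n)$ ($R$ a relation symbol, $t_i$ terms; there is no equality). $L$ has approximations for $\mathcal K$: there are a dense set $D\subseteq[0,\infty)$ with $0\in D$, closed under addition, and maps $\mathrm{Appr}\colon\Phi\times D\to\Phi$, $\mathrm{neg}\colon\Phi\to\Phi$ such that (all statements for all $\varphi\in\Phi$, $\mathcal A\in\mathcal K$, tuples $\bar a$ of $\mathcal A$, and $\varepsilon,\delta\in D$): $\mathrm{Appr}(\varphi,\varepsilon)$ and $\mathrm{neg}(\varphi)$ have the same variables as $\varphi$; $\mathrm{Appr}(\varphi,0)\equiv\varphi$; $\mathrm{Appr}(\mathrm{Appr}(\varphi,\varepsilon),\delta)\equiv\mathrm{Appr}(\varphi,\varepsilon+\delta)$; $\varphi\models\mathrm{Appr}(\varphi,\varepsilon)$; $\mathcal A\models\varphi(\bar a)$ iff $\mathcal A\models\mathrm{Appr}(\varphi,\varepsilon)(\bar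 a)$ for all $\varepsilon\in D\setminus\{0\}$; $\mathrm{neg}(\mathrm{neg}(\varphi))=\varphi$; $\mathcal A\not\models\varphi(\bar a)$ iff $\mathcal A\models\mathrm{neg}(\mathrm{Appr}(\varphi,\varepsilon))(\bar a)$ for some $\varepsilon\in D\setminus\{0\}$; if $\varepsilon\geq\delta>0$ then $\mathrm{Appr}(\mathrm{neg}(\mathrm{Appr}(\varphi,\varepsilon)),\delta)\equiv\mathrm{neg}(\mathrm{Appr}(\varphi,\varepsilon-\delta))$. Each $\mathcal A\in\mathcal K$ carries a complete metric $d_{\mathcal A}$ such that for each $r\in D$ the set $\{(a,a'):d(a,a')\leq r\}$ is defined by an atomic formula; density, separability, Cauchy sequences and limits refer to this metric, and for tuples $d(\bar a,\bar b)<\delta$ means coordinatewise. All real parameters below range over $D$. An isomorphism notion is a family $\mathcal I=(\mathcal I_\varepsilon)_{\varepsilon\geq0}$ of classes of bijections $f\colon\mathcal A\to\mathcal B$ ($\mathcal A,\mathcal B\in\mathcal K$) ("$\varepsilon$-isomorphisms") such that: every $L$-isomorphism between members of $\mathcal K$ is in $\mathcal I_0$; $f\in\mathcal I_\varepsilon\Rightarrow f^{-1}\in\mathcal I_\varepsilon$; $f\in\mathcal I_\varepsilon$, $g\in\mathcal I_{\varepsilon'}$, $\mathrm{ran}(f)=\mathrm{dom}(g)$ $\Rightarrow g\circ f\in\mathcal I_{\varepsilon+\varepsilon'}$; $\varepsilon\leq\varepsilon'\Rightarrow\mathcal I_\varepsilon\subseteq\mathcal I_{\varepsilon'}$; a surjection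 $f\colon\mathcal A\to\mathcal B$ is in $\mathcal I_\varepsilon$ iff for all atomic $\varphi(\bar v)$ and $\bar a$, $\mathcal A\models\varphi(\bar a)\Rightarrow\mathcal B\models\mathrm{Appr}(\varphi,\varepsilon)(f(\bar a))$. $L$ is good for $(\mathcal K,\mathcal I)$: there are sets $\mathrm{Good}(k)\subseteq\Phi$, $k<\omega$, with: every atomic formula is equivalent to a member of some $\mathrm{Good}(k)$; $\mathrm{Good}(k)\subseteq\mathrm{Good}(k+1)$; if $\varphi\in\mathrm{Good}(k)$ then $\mathrm{Appr}(\varphi,\varepsilon)$ and $\mathrm{neg}(\mathrm{Appr}(\varphi,\varepsilon))$ lie in $\mathrm{Good}(\lceil ke^\varepsilon\rceil)$; for every $\mathcal A\in\mathcal K$, $k<\omega$, $\varepsilon>0$ there is $\delta>0$ with: for all $\varphi(\bar v)\in\mathrm{Good}(k)$ and $\bar a,\bar b$ with $d(\bar a,\bar b)<\delta$, $\mathcal A\models\varphi(\bar a)\Rightarrow\mathcal A\models\mathrm{Appr}(\varphi,\varepsilon)(\bar b)$; and for $\mathcal A,\mathcal B\in\mathcal K$, $\varepsilon\geq0$, sequences $(a_n)$ in $\mathcal A$, $(b_n)$ in $\mathcal B$ and a sequence $(\varepsilon_n)$ in $(\varepsilon,\infty)$ converging down to $\varepsilon$ such that for all $k$, all $\varphi(v_0,\dots,v_{m-1})\in\mathrm{Good}(k)$ and all $i_0,\dots,i_{m-1}\geq k$, $\mathcal A\models\varphi(a_{i_0},\dots,a_{i_{m-1}})\Rightarrow\mathcal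 B\models\mathrm{Appr}(\varphi,\varepsilon_k)(b_{i_0},\dots,b_{i_{m-1}})$, for every increasing $(i_n)$, $(a_{i_n})$ is Cauchy iff $(b_{i_n})$ is Cauchy. The game $\mathrm{EF}^{\omega,\varepsilon}(\hat{\mathcal A},\hat{\mathcal B})$ for dense $\hat{\mathcal A}\subseteq\mathcal A$, $\hat{\mathcal B}\subseteq\mathcal B$ (structures treated as disjoint) has $\omega$ rounds; in round $k$ player I picks $x_k\in\hat{\mathcal A}\cup\hat{\mathcal B}$ and $\varepsilon_k>\varepsilon$, and II answers $y_k$ in $\hat{\mathcal B}$ if $x_k\in\hat{\mathcal A}$ and in $\hat{\mathcal A}$ otherwise; $a_k$ (resp. $b_k$) denotes whichever of $x_k,y_k$ lies in $\hat{\mathcal A}$ (resp. $\hat{\mathcal B}$). II wins iff for all $k<\omega$, all $\varphi(v_0,\dots,v_{m-1})\in\mathrm{Good}(k)$ and all $i_0,\dots,i_{m-1}\geq k$: $\mathcal A\models\varphi(a_{i_0},\dots,a_{i_{m-1}})\Rightarrow\mathcal B\models\mathrm{Appr}(\varphi,\varepsilon_k)(b_{i_0},\dots,b_{i_{m-1}})$.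
   Formalization: "Every atomic formula is equivalent to a member ψ of some Good(k)" is strengthened: Appr(φ,ε) and Appr(ψ,ε) must be equivalent on K for every ε in D; with bare equivalence the theorem is false. D is taken closed under differences ε−δ ≥ 0, as the last Appr/neg axiom presupposes. *)

theory Defs
  imports "HOL-Analysis.Analysis"
begin

section \<open>Vocabularies, atomic formulas, structures\<close>

text \<open>The symbols are given by sets rather than by whole types, so that a vocabulary may have no
  function symbols. Constants are function symbols of arity 0.\<close>

record ('f, 'r) vocabulary =
  Funs :: "'f set"
  Rels :: "'r set"
  farity :: "'f \<Rightarrow> nat"
  rarity :: "'r \<Rightarrow> nat"

datatype 'f trm = Var nat | App 'f "'f trm list"

datatype ('f, 'r) atm = Rel 'r "'f trm list"

fun wf_trm :: "('f, 'r) vocabulary \<Rightarrow> 'f trm \<Rightarrow> bool" where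
  "wf_trm L (Var n) \<longleftrightarrow> True"
| "wf_trm L (App F ts) \<longleftrightarrow>
     F \<in> Funs L \<and> length ts = farity L F \<and> (\<forall>t \<in> set ts. wf_trm L t)"

definition atoms :: "('f, 'r) vocabulary \<Rightarrow> ('f, 'r) atm set" where
  "atoms L = {Rel R ts | R ts.
     R \<in> Rels L \<and> length ts = rarity L R \<and> (\<forall>t \<in> set ts. wf_trm L t)}"

primrec tvars :: "'f trm \<Rightarrow> nat set" where
  "tvars (Var n) = {n}"
| "tvars (App F ts) = \<Union> (set (map tvars ts))"

primrec vars :: "('f, 'r) atm \<Rightarrow> nat set" where
  "vars (Rel R ts) = \<Union> (set (map tvars ts))"

record ('f, 'r, 'a) struct =
  univ :: "'a set"
  fint :: "'f \<Rightarrow> 'a list \<Rightarrow> 'a"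
  rint :: "'r \<Rightarrow> 'a list \<Rightarrow> bool"

definition is_struct :: "('f, 'r) vocabulary \<Rightarrow> ('f, 'r, 'a) struct \<Rightarrow> bool" where
  "is_struct L A \<longleftrightarrow> univ A \<noteq> {} \<and>
     (\<forall>F \<in> Funs L. \<forall>xs. set xs \<subseteq> univ A \<and> length xs = farity L F \<longrightarrow> fint A F xs \<in> univ A)"

primrec eval :: "('f, 'r, 'a) struct \<Rightarrow> (nat \<Rightarrow> 'a) \<Rightarrow> 'f trm \<Rightarrow> 'a" where
  "eval A s (Var n) = s n"
| "eval A s (App F ts) = fint A F (map (eval A s) ts)"

text \<open>A tuple interpreting the variables of a formula is rendered as an assignment of elements of
  the universe to all variables \<open>v\<^sub>0, v\<^sub>1, \<dots>\<close>; only the values at \<open>vars \<phi>\<close> matter, and every tuple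
  extends to an assignment because universes are nonempty.\<close>

primrec sat :: "('f, 'r, 'a) struct \<Rightarrow> (nat \<Rightarrow> 'a) \<Rightarrow> ('f, 'r) atm \<Rightarrow> bool" where
  "sat A s (Rel R ts) \<longleftrightarrow> rint A R (map (eval A s) ts)"

definition entails :: "('f, 'r, 'a) struct set \<Rightarrow> ('f, 'r) atm \<Rightarrow> ('f, 'r) atm \<Rightarrow> bool" where
  "entails K \<phi> \<psi> \<longleftrightarrow> (\<forall>A \<in> K. \<forall>s. range s \<subseteq> univ A \<longrightarrow> sat A s \<phi> \<longrightarrow> sat A s \<psi>)"

definition equivalent :: "('f, 'r, 'a) struct set \<Rightarrow> ('f, 'r) atm \<Rightarrow> ('f, 'r) atm \<Rightarrow> bool" where
  "equivalent K \<phi> \<psi> \<longleftrightarrow> (\<forall>A \<in> K. \<forall>s. range s \<subseteq> univ A \<longrightarrow> sat A s \<phi> = sat A s \<psi>)"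

definition L_isomorphism ::
    "('f, 'r) vocabulary \<Rightarrow> ('f, 'r, 'a) struct \<Rightarrow> ('f, 'r, 'a) struct \<Rightarrow> ('a \<Rightarrow> 'a) \<Rightarrow> bool" where
  "L_isomorphism L A B f \<longleftrightarrow> bij_betw f (univ A) (univ B) \<and>
     (\<forall>F \<in> Funs L. \<forall>xs. set xs \<subseteq> univ A \<and> length xs = farity L F \<longrightarrow>
        f (fint A F xs) = fint B F (map f xs)) \<and>
     (\<forall>R \<in> Rels L. \<forall>xs. set xs \<subseteq> univ A \<and> length xs = rarity L R \<longrightarrow>
        rint A R xs = rint B R (map f xs))"


section \<open>Approximations\<close>

text \<open>All members of \<open>K\<close> have their universe inside one (arbitrary) type. Nothing is lost: the
  assumptions below pass to subclasses and to isomorphic copies, so for given \<open>A\<close> and \<open>B\<close> one may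
  take any type that has room for both.

  Closure of \<open>D\<close> under differences is what makes \<open>Appr \<phi> (\<epsilon> - \<delta>)\<close> in the last axiom
  meaningful, \<open>Appr\<close> being a map on \<open>\<Phi> \<times> D\<close>.\<close>

locale approximations =
  fixes L :: "('f, 'r) vocabulary"
    and K :: "('f, 'r, 'a) struct set"
    and D :: "real set"
    and Appr :: "('f, 'r) atm \<Rightarrow> real \<Rightarrow> ('f, 'r) atm"
    and neg :: "('f, 'r) atm \<Rightarrow> ('f, 'r) atm"
  assumes structs: "A \<in> K \<Longrightarrow> is_struct L A"
    and D_nonneg: "D \<subseteq> {0..}"
    and D_dense: "{0..} \<subseteq> closure D"
    and D_zero: "0 \<in> D"
    and D_add: "\<epsilon> \<in> D \<Longrightarrow> \<delta> \<in> D \<Longrightarrow> \<epsilon> + \<delta> \<in> D"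
    and D_diff: "\<epsilon> \<in> D \<Longrightarrow> \<delta> \<in> D \<Longrightarrow> \<delta> \<le> \<epsilon> \<Longrightarrow> \<epsilon> - \<delta> \<in> D"
    and Appr_atom: "\<phi> \<in> atoms L \<Longrightarrow> \<epsilon> \<in> D \<Longrightarrow> Appr \<phi> \<epsilon> \<in> atoms L"
    and neg_atom: "\<phi> \<in> atoms L \<Longrightarrow> neg \<phi> \<in> atoms L"
    and Appr_vars: "\<phi> \<in> atoms L \<Longrightarrow> \<epsilon> \<in> D \<Longrightarrow> vars (Appr \<phi> \<epsilon>) = vars \<phi>"
    and neg_vars: "\<phi> \<in> atoms L \<Longrightarrow> vars (neg \<phi>) = vars \<phi>"
    and Appr_zero: "\<phi> \<in> atoms L \<Longrightarrow> equivalent K (Appr \<phi> 0) \<phi>"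
    and Appr_Appr: "\<phi> \<in> atoms L \<Longrightarrow> \<epsilon> \<in> D \<Longrightarrow> \<delta> \<in> D \<Longrightarrow>
          equivalent K (Appr (Appr \<phi> \<epsilon>) \<delta>) (Appr \<phi> (\<epsilon> + \<delta>))"
    and entails_Appr: "\<phi> \<in> atoms L \<Longrightarrow> \<epsilon> \<in> D \<Longrightarrow> entails K \<phi> (Appr \<phi> \<epsilon>)"
    and sat_iff_Appr: "\<phi> \<in> atoms L \<Longrightarrow> A \<in> K \<Longrightarrow> range s \<subseteq> univ A \<Longrightarrow>
          sat A s \<phi> \<longleftrightarrow> (\<forall>\<epsilon> \<in> D - {0}. sat A s (Appr \<phi> \<epsilon>))"
    and neg_neg: "\<phi> \<in> atoms L \<Longrightarrow> neg (neg \<phi>) = \<phi>"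
    and not_sat_iff: "\<phi> \<in> atoms L \<Longrightarrow> A \<in> K \<Longrightarrow> range s \<subseteq> univ A \<Longrightarrow>
          \<not> sat A s \<phi> \<longleftrightarrow> (\<exists>\<epsilon> \<in> D - {0}. sat A s (neg (Appr \<phi> \<epsilon>)))"
    and Appr_neg_Appr: "\<phi> \<in> atoms L \<Longrightarrow> \<epsilon> \<in> D \<Longrightarrow> \<delta> \<in> D \<Longrightarrow> 0 < \<delta> \<Longrightarrow> \<delta> \<le> \<epsilon> \<Longrightarrow>
          equivalent K (Appr (neg (Appr \<phi> \<epsilon>)) \<delta>) (neg (Appr \<phi> (\<epsilon> - \<delta>)))"

locale metric_structures =
  fixes L :: "('f, 'r) vocabulary"
    and K :: "('f, 'r, 'a) struct set"
    and D :: "real set"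
    and d :: "('f, 'r, 'a) struct \<Rightarrow> 'a \<Rightarrow> 'a \<Rightarrow> real"
  assumes metric: "A \<in> K \<Longrightarrow> Metric_space (univ A) (d A)"
    and complete: "A \<in> K \<Longrightarrow> Metric_space.mcomplete (univ A) (d A)"
    and definable: "A \<in> K \<Longrightarrow> r \<in> D \<Longrightarrow>
          \<exists>\<phi> \<in> atoms L. vars \<phi> \<subseteq> {0, 1} \<and>
            (\<forall>x \<in> univ A. \<forall>y \<in> univ A. sat A (\<lambda>n. if n = 0 then x else y) \<phi> \<longleftrightarrow> d A x y \<le> r)"


section \<open>Isomorphism notions\<close>

text \<open>\<open>Iso \<epsilon> A B f\<close> says that \<open>f\<close>, restricted to \<open>univ A\<close>, is an \<open>\<epsilon>\<close>-isomorphism from \<open>A\<close> to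
  \<open>B\<close>. By \<open>Iso_iff\<close> the values of \<open>f\<close> outside \<open>univ A\<close> are irrelevant.\<close>

locale isomorphism_notion =
  fixes L :: "('f, 'r) vocabulary"
    and K :: "('f, 'r, 'a) struct set"
    and D :: "real set"
    and Appr :: "('f, 'r) atm \<Rightarrow> real \<Rightarrow> ('f, 'r) atm"
    and Iso :: "real \<Rightarrow> ('f, 'r, 'a) struct \<Rightarrow> ('f, 'r, 'a) struct \<Rightarrow> ('a \<Rightarrow> 'a) \<Rightarrow> bool"
  assumes Iso_bij: "\<epsilon> \<in> D \<Longrightarrow> Iso \<epsilon> A B f \<Longrightarrow> A \<in> K \<and> B \<in> K \<and> bij_betw f (univ A) (univ B)"
    and Iso_L_isomorphism: "A \<in> K \<Longrightarrow> B \<in> K \<Longrightarrow> L_isomorphism L A B f \<Longrightarrow> Iso 0 A B f"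
    and Iso_inverse: "\<epsilon> \<in> D \<Longrightarrow> Iso \<epsilon> A B f \<Longrightarrow> Iso \<epsilon> B A (inv_into (univ A) f)"
    and Iso_comp: "\<epsilon> \<in> D \<Longrightarrow> \<epsilon>' \<in> D \<Longrightarrow> Iso \<epsilon> A B f \<Longrightarrow> Iso \<epsilon>' B C g \<Longrightarrow>
          Iso (\<epsilon> + \<epsilon>') A C (g \<circ> f)"
    and Iso_mono: "\<epsilon> \<in> D \<Longrightarrow> \<epsilon>' \<in> D \<Longrightarrow> \<epsilon> \<le> \<epsilon>' \<Longrightarrow> Iso \<epsilon> A B f \<Longrightarrow> Iso \<epsilon>' A B f"
    and Iso_iff: "\<epsilon> \<in> D \<Longrightarrow> A \<in> K \<Longrightarrow> B \<in> K \<Longrightarrow> f ` univ A = univ B \<Longrightarrow>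
          Iso \<epsilon> A B f \<longleftrightarrow>
            (\<forall>\<phi> \<in> atoms L. \<forall>s. range s \<subseteq> univ A \<longrightarrow> sat A s \<phi> \<longrightarrow> sat B (f \<circ> s) (Appr \<phi> \<epsilon>))"


section \<open>Good vocabularies\<close>

text \<open>In the next definition \<open>i\<close> maps the (index of the) variable \<open>v\<^sub>j\<close> to the index \<open>i\<^sub>j\<close>.\<close>

definition good_match ::
    "(('f, 'r) atm \<Rightarrow> real \<Rightarrow> ('f, 'r) atm) \<Rightarrow> (nat \<Rightarrow> ('f, 'r) atm set) \<Rightarrow>
     ('f, 'r, 'a) struct \<Rightarrow> ('f, 'r, 'a) struct \<Rightarrow>
     (nat \<Rightarrow> 'a) \<Rightarrow> (nat \<Rightarrow> 'a) \<Rightarrow> (nat \<Rightarrow> real) \<Rightarrow> bool" where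
  "good_match Appr Good A B a b e \<longleftrightarrow>
     (\<forall>k. \<forall>\<phi> \<in> Good k. \<forall>i. (\<forall>j. k \<le> i j) \<longrightarrow>
        sat A (\<lambda>j. a (i j)) \<phi> \<longrightarrow> sat B (\<lambda>j. b (i j)) (Appr \<phi> (e k)))"

text \<open>In \<open>Good_cover\<close>, an atomic formula and its equivalent in \<open>Good k\<close> are required to have
  equivalent approximations (the case \<open>\<epsilon> = 0\<close> is equivalence of the two formulas themselves):
  equivalence is read as compatible with \<open>Appr\<close>. The axioms for \<open>Appr\<close> do not imply this, since
  equivalent atomic formulas may have inequivalent approximations; and it cannot be dropped,
  because \<open>\<epsilon>\<close>-isomorphisms are tested on all atomic formulas but the game only on good ones.\<close>

locale good_vocabulary =
  fixes L :: "('f, 'r) vocabulary"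
    and K :: "('f, 'r, 'a) struct set"
    and D :: "real set"
    and Appr :: "('f, 'r) atm \<Rightarrow> real \<Rightarrow> ('f, 'r) atm"
    and neg :: "('f, 'r) atm \<Rightarrow> ('f, 'r) atm"
    and d :: "('f, 'r, 'a) struct \<Rightarrow> 'a \<Rightarrow> 'a \<Rightarrow> real"
    and Good :: "nat \<Rightarrow> ('f, 'r) atm set"
  assumes Good_atoms: "Good k \<subseteq> atoms L"
    and Good_cover: "\<phi> \<in> atoms L \<Longrightarrow>
          \<exists>k. \<exists>\<psi> \<in> Good k. \<forall>\<epsilon> \<in> D. equivalent K (Appr \<phi> \<epsilon>) (Appr \<psi> \<epsilon>)"
    and Good_Suc: "Good k \<subseteq> Good (Suc k)"
    and Good_Appr: "\<phi> \<in> Good k \<Longrightarrow> \<epsilon> \<in> D \<Longrightarrow> Appr \<phi> \<epsilon> \<in> Good (nat \<lceil>real k * exp \<epsilon>\<rceil>)"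
    and Good_neg_Appr:
          "\<phi> \<in> Good k \<Longrightarrow> \<epsilon> \<in> D \<Longrightarrow> neg (Appr \<phi> \<epsilon>) \<in> Good (nat \<lceil>real k * exp \<epsilon>\<rceil>)"
    and Good_uniform: "A \<in> K \<Longrightarrow> \<epsilon> \<in> D \<Longrightarrow> 0 < \<epsilon> \<Longrightarrow>
          \<exists>\<delta> \<in> D. 0 < \<delta> \<and>
            (\<forall>\<phi> \<in> Good k. \<forall>s t. range s \<subseteq> univ A \<longrightarrow> range t \<subseteq> univ A \<longrightarrow>
               (\<forall>v \<in> vars \<phi>. d A (s v) (t v) < \<delta>) \<longrightarrow> sat A s \<phi> \<longrightarrow> sat A t (Appr \<phi> \<epsilon>))"
    and Good_Cauchy: "A \<in> K \<Longrightarrow> B \<in> K \<Longrightarrow> \<epsilon> \<in> D \<Longrightarrow>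
          range a \<subseteq> univ A \<Longrightarrow> range b \<subseteq> univ B \<Longrightarrow>
          (\<And>n. e n \<in> D \<and> \<epsilon> < e n) \<Longrightarrow> decseq e \<Longrightarrow> e \<longlonglongrightarrow> \<epsilon> \<Longrightarrow>
          good_match Appr Good A B a b e \<Longrightarrow> strict_mono i \<Longrightarrow>
          Metric_space.MCauchy (univ A) (d A) (a \<circ> i) \<longleftrightarrow>
          Metric_space.MCauchy (univ B) (d B) (b \<circ> i)"


section \<open>The game\<close>

text \<open>\<open>x k\<close> is \<open>Inl a\<close> if player I picks \<open>a\<close> on the side of \<open>A\<close>, and \<open>Inr b\<close> if he picks \<open>b\<close> on the
  side of \<open>B\<close>; the tags make the two sides disjoint. A strategy \<open>\<sigma>\<close> of player II maps the finite
  list of moves of player I made so far, including the one to be answered, to an element of the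
  opposite side.\<close>

definition answer ::
    "((('a + 'a) \<times> real) list \<Rightarrow> 'a) \<Rightarrow> (nat \<Rightarrow> 'a + 'a) \<Rightarrow> (nat \<Rightarrow> real) \<Rightarrow> nat \<Rightarrow> 'a" where
  "answer \<sigma> x e k = \<sigma> (map (\<lambda>n. (x n, e n)) [0..<Suc k])"

definition left_elem :: "(nat \<Rightarrow> 'a + 'a) \<Rightarrow> (nat \<Rightarrow> 'a) \<Rightarrow> nat \<Rightarrow> 'a" where
  "left_elem x y k = (case x k of Inl u \<Rightarrow> u | Inr _ \<Rightarrow> y k)"

definition right_elem :: "(nat \<Rightarrow> 'a + 'a) \<Rightarrow> (nat \<Rightarrow> 'a) \<Rightarrow> nat \<Rightarrow> 'a" where
  "right_elem x y k = (case x k of Inl _ \<Rightarrow> y k | Inr v \<Rightarrow> v)"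

text \<open>The game \<open>EF\<^sup>\<omega>\<^sup>,\<^sup>\<epsilon>\<close> between subsets \<open>P\<close> of \<open>A\<close> and \<open>Q\<close> of \<open>B\<close>.\<close>

definition winning_strategy ::
    "real set \<Rightarrow> (('f, 'r) atm \<Rightarrow> real \<Rightarrow> ('f, 'r) atm) \<Rightarrow> (nat \<Rightarrow> ('f, 'r) atm set) \<Rightarrow>
     real \<Rightarrow> ('f, 'r, 'a) struct \<Rightarrow> 'a set \<Rightarrow> ('f, 'r, 'a) struct \<Rightarrow> 'a set \<Rightarrow>
     ((('a + 'a) \<times> real) list \<Rightarrow> 'a) \<Rightarrow> bool" where
  "winning_strategy D Appr Good \<epsilon> A P B Q \<sigma> \<longleftrightarrow>
     (\<forall>x e. (\<forall>k. x k \<in> P <+> Q \<and> e k \<in> D \<and> \<epsilon> < e k) \<longrightarrow>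
        (\<forall>k. answer \<sigma> x e k \<in> (case x k of Inl _ \<Rightarrow> Q | Inr _ \<Rightarrow> P)) \<and>
        good_match Appr Good A B
          (left_elem x (answer \<sigma> x e)) (right_elem x (answer \<sigma> x e)) e)"

definition II_wins_EF ::
    "real set \<Rightarrow> (('f, 'r) atm \<Rightarrow> real \<Rightarrow> ('f, 'r) atm) \<Rightarrow> (nat \<Rightarrow> ('f, 'r) atm set) \<Rightarrow>
     real \<Rightarrow> ('f, 'r, 'a) struct \<Rightarrow> 'a set \<Rightarrow> ('f, 'r, 'a) struct \<Rightarrow> 'a set \<Rightarrow> bool" where
  "II_wins_EF D Appr Good \<epsilon> A P B Q \<longleftrightarrow> (\<exists>\<sigma>. winning_strategy D Appr Good \<epsilon> A P B Q \<sigma>)"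

end

theory Submission
  imports Defs
begin

text \<open>An \<open>\<epsilon>\<close>-isomorphism \<open>f\<close> gives a winning strategy: answer with \<open>f\<close> and its inverse. Conversely,
  let player I enumerate countable dense subsets of both structures, each point infinitely often,
  while his error bounds decrease to \<open>\<epsilon>\<close>. In the resulting play \<open>(a\<^sub>n, b\<^sub>n)\<close> a subsequence of
  \<open>(a\<^sub>n)\<close> is Cauchy iff the corresponding subsequence of \<open>(b\<^sub>n)\<close> is, so by completeness the
  cluster points of the sequence of pairs form the graph of a surjection \<open>A \<rightarrow> B\<close>. It is an
  \<open>\<epsilon>\<close>-isomorphism because good formulas are uniformly continuous up to an approximation.\<close>

section \<open>Joint cluster points of two sequences in metric spaces\<close>

text \<open>One index \<open>n\<close> must serve both coordinates, so \<open>(x, y)\<close> is a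
  cluster point of the sequence of pairs in the product space. This is stronger than clustering in
  each coordinate separately.\<close>

definition joint_cluster ::
    "('a \<Rightarrow> 'a \<Rightarrow> real) \<Rightarrow> ('b \<Rightarrow> 'b \<Rightarrow> real) \<Rightarrow> (nat \<Rightarrow> 'a) \<Rightarrow> (nat \<Rightarrow> 'b) \<Rightarrow> 'a \<Rightarrow> 'b \<Rightarrow> bool" where
  "joint_cluster d d' a b x y \<longleftrightarrow>
     (\<forall>r>0. \<forall>N. \<exists>n\<ge>N. d (a n) x < r \<and> d' (b n) y < r)"

lemma joint_cluster_commute: "joint_cluster d d' a b x y \<longleftrightarrow> joint_cluster d' d b a y x"
  by (auto simp: joint_cluster_def conj_commute)

lemma ex_strict_mono_choice:
  fixes P :: "nat \<Rightarrow> nat \<Rightarrow> bool"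
  assumes "\<And>n N. \<exists>m\<ge>N. P n m"
  shows "\<exists>j. strict_mono j \<and> (\<forall>n. P n (j n))"
proof -
  have "\<exists>j. \<forall>n. P n (j n) \<and> j n < j (Suc n)"
  proof (rule dependent_nat_choice)
    show "\<exists>x. P 0 x" using assms by blast
    show "\<exists>y. P (Suc n) y \<and> x < y" for x n
      using assms[of "Suc x" "Suc n"] by (auto simp: Suc_le_eq)
  qed
  then show ?thesis by (auto simp: strict_mono_Suc_iff)
qed

lemma (in Metric_space) MCauchy_of_inverse_Suc_bound:
  assumes "range a \<subseteq> M" "x \<in> M" "\<And>n. d (a n) x < inverse (Suc n)"
  shows "MCauchy a"
proof -
  have "limitin mtopology a x sequentially"
    unfolding limit_metric_sequentially
  proof (intro conjI allI impI)
    fix r :: real assume "0 < r"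
    then obtain N where N: "inverse (Suc N) < r" using reals_Archimedean by blast
    have "a n \<in> M \<and> d (a n) x < r" if "N \<le> n" for n
    proof -
      have "inverse (real (Suc n)) \<le> inverse (Suc N)" using that by (simp add: field_simps)
      then have "d (a n) x < r" using assms(3)[of n] N by linarith
      then show ?thesis using assms(1) by auto
    qed
    then show "\<exists>N. \<forall>n\<ge>N. a n \<in> M \<and> d (a n) x < r" by blast
  qed (fact assms(2))
  then show ?thesis using assms(1) convergent_imp_MCauchy by blast
qed

text \<open>Interleave indices good for \<open>(x, y)\<close> with indices good for
  \<open>(x, y')\<close>. Along them \<open>a\<close> still converges to \<open>x\<close>, so by
  \<open>Cauchy\<close> the corresponding terms of \<open>b\<close> are Cauchy, although they
  approach \<open>y\<close> and \<open>y'\<close> alternately.\<close>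

lemma joint_cluster_unique:
  assumes M: "Metric_space M d" and M': "Metric_space M' d'"
    and a: "range a \<subseteq> M" and b: "range b \<subseteq> M'"
    and Cauchy: "\<And>i. strict_mono i \<Longrightarrow> Metric_space.MCauchy M d (a \<circ> i) \<Longrightarrow>
                   Metric_space.MCauchy M' d' (b \<circ> i)"
    and x: "x \<in> M" and y: "y \<in> M'" "y' \<in> M'"
    and xy: "joint_cluster d d' a b x y" "joint_cluster d d' a b x y'"
  shows "y = y'"
proof (rule ccontr)
  assume "y \<noteq> y'"
  interpret A: Metric_space M d by (fact M)
  interpret B: Metric_space M' d' by (fact M')
  have "\<exists>m\<ge>N. d (a m) x < inverse (Suc n) \<and> d' (b m) (if even n then y else y') < inverse (Suc n)"
    for n N
    using xy by (auto simp: joint_cluster_def)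
  from ex_strict_mono_choice[of "\<lambda>n m. d (a m) x < inverse (Suc n) \<and>
      d' (b m) (if even n then y else y') < inverse (Suc n)", OF this]
  obtain j where j: "strict_mono j" "\<And>n. d (a (j n)) x < inverse (Suc n)"
    "\<And>n. d' (b (j n)) (if even n then y else y') < inverse (Suc n)" by auto
  have "A.MCauchy (a \<circ> j)"
    by (rule A.MCauchy_of_inverse_Suc_bound[OF _ x]) (use a j(2) in auto)
  then have C: "B.MCauchy (b \<circ> j)" using Cauchy j(1) by blast
  \<comment> \<open>The path from \<open>y\<close> through \<open>b (j n)\<close> and
    \<open>b (j (Suc n))\<close> to \<open>y'\<close> has three legs, each to be made shorter than a
    third of the distance.\<close>
  define r where "r = d' y y' / 3"
  have r: "0 < r" using \<open>y \<noteq> y'\<close> y by (simp add: r_def)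
  obtain N where N: "\<And>n n'. N \<le> n \<Longrightarrow> N \<le> n' \<Longrightarrow> d' (b (j n)) (b (j n')) < r"
    using C r unfolding B.MCauchy_def comp_def by blast
  obtain N' where N': "inverse (real (Suc N')) < r" using reals_Archimedean r by blast
  \<comment> \<open>Even and past both thresholds, so \<open>n\<close> gives a term near
    \<open>y\<close> and \<open>Suc n\<close> a term near \<open>y'\<close>.\<close>
  define n where "n = 2 * (N + N')"
  have "inverse (real (Suc n)) \<le> inverse (Suc N')" "inverse (real (Suc (Suc n))) \<le> inverse (Suc N')"
    by (simp_all add: n_def field_simps)
  moreover have even: "even n = True" "even (Suc n) = False" by (simp_all add: n_def)
  ultimately have "d' (b (j n)) y < r" "d' (b (j (Suc n))) y' < r"
    using j(3)[of n] j(3)[of "Suc n"] N' unfolding even if_True if_False by linarith+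
  moreover have "d' (b (j n)) (b (j (Suc n))) < r" by (rule N) (auto simp: n_def)
  moreover have mem: "b (j n) \<in> M'" "b (j (Suc n)) \<in> M'" using b by auto
  moreover have "d' y y' \<le> d' (b (j n)) y + (d' (b (j n)) (b (j (Suc n))) + d' (b (j (Suc n))) y')"
    using B.triangle''[of y "b (j n)" y'] B.triangle[of "b (j n)" "b (j (Suc n))" y'] mem y by linarith
  ultimately show False by (simp add: r_def)
qed

text \<open>A subsequence of \<open>a\<close> tending to \<open>x\<close> is Cauchy, hence so is the
  same subsequence of \<open>b\<close>; its limit, which exists by completeness, is the required
  \<open>y\<close>.\<close>

lemma joint_cluster_exists:
  assumes M: "Metric_space M d" and M': "Metric_space M' d'"
    and complete: "Metric_space.mcomplete M' d'"
    and a: "range a \<subseteq> M"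
    and Cauchy: "\<And>i. strict_mono i \<Longrightarrow> Metric_space.MCauchy M d (a \<circ> i) \<Longrightarrow>
                   Metric_space.MCauchy M' d' (b \<circ> i)"
    and x: "x \<in> M"
    and freq: "\<And>r N. 0 < r \<Longrightarrow> \<exists>n\<ge>N. d (a n) x < r"
  shows "\<exists>y \<in> M'. joint_cluster d d' a b x y"
proof -
  interpret A: Metric_space M d by (fact M)
  interpret B: Metric_space M' d' by (fact M')
  have "\<exists>m\<ge>N. d (a m) x < inverse (Suc n)" for n N using freq by simp
  from ex_strict_mono_choice[of "\<lambda>n m. d (a m) x < inverse (Suc n)", OF this]
  obtain j where j: "strict_mono j" "\<And>n. d (a (j n)) x < inverse (Suc n)" by auto
  have "A.MCauchy (a \<circ> j)"
    by (rule A.MCauchy_of_inverse_Suc_bound[OF _ x]) (use a j(2) in auto)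
  then have "B.MCauchy (b \<circ> j)" using Cauchy j(1) by blast
  then obtain y where y: "limitin B.mtopology (b \<circ> j) y sequentially"
    using complete by (auto simp: B.mcomplete_def)
  have "joint_cluster d d' a b x y"
    unfolding joint_cluster_def
  proof (intro allI impI)
    fix r :: real and N assume r: "0 < r"
    obtain N1 where N1: "\<And>n. N1 \<le> n \<Longrightarrow> d' (b (j n)) y < r"
      using y r unfolding B.limit_metric_sequentially comp_def by blast
    obtain N2 where N2: "inverse (real (Suc N2)) < r" using reals_Archimedean r by blast
    \<comment> \<open>Past all three thresholds at once; \<open>seq_suble\<close> turns
      \<open>N \<le> n\<close> into \<open>N \<le> j n\<close>.\<close>
    define n where "n = N + N1 + N2"
    have "inverse (real (Suc n)) \<le> inverse (Suc N2)" by (simp add: n_def field_simps)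
    then have "d (a (j n)) x < r" using j(2)[of n] N2 by linarith
    moreover have "d' (b (j n)) y < r" by (rule N1) (simp add: n_def)
    moreover have "N \<le> j n" using seq_suble[OF j(1), of n] by (simp add: n_def)
    ultimately show "\<exists>n\<ge>N. d (a n) x < r \<and> d' (b n) y < r" by blast
  qed
  then show ?thesis using y by (auto simp: B.limit_metric_sequentially)
qed

section \<open>Enumerations with infinite repetition\<close>

text \<open>Read \<open>n\<close> as the code of a pair and use only its first component: the free
  second component produces arbitrarily large codes for every element.\<close>

lemma enumeration_infinitely_often:
  assumes "countable S" "S \<noteq> {}"
  obtains x where "range x = S" "\<And>s N. s \<in> S \<Longrightarrow> \<exists>n\<ge>N. x (n::nat) = s"
proof -
  let ?x = "\<lambda>n. from_nat_into S (fst (prod_decode n))"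
  have *: "\<exists>n\<ge>N. ?x n = s" if "s \<in> S" for s N
  proof -
    obtain m where m: "from_nat_into S m = s"
      using from_nat_into_surj[OF \<open>countable S\<close> \<open>s \<in> S\<close>] by blast
    show ?thesis
      by (rule exI[of _ "prod_encode (m, N)"]) (simp add: m le_prod_encode_2)
  qed
  moreover have "range ?x = S" using * from_nat_into[OF assms(2)] by blast
  ultimately show ?thesis using that[of ?x] by blast
qed

text \<open>Repetition matters because \<open>joint_cluster\<close> asks for arbitrarily late terms,
  even near an isolated point.\<close>

lemma (in Metric_space) frequently_near:
  assumes "C \<subseteq> M" "mtopology closure_of C = M" "x \<in> M"
    and inf: "\<And>c N. c \<in> C \<Longrightarrow> \<exists>n\<ge>N. a n = c" and "(0::real) < r"
  shows "\<exists>n\<ge>(N::nat). d (a n) x < r"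
proof -
  have "x \<in> mtopology closure_of C" using assms by simp
  then obtain c where c: "c \<in> C" "d x c < r" using \<open>0 < r\<close> by (auto simp: metric_closure_of)
  then show ?thesis using inf[OF c(1), of N] commute by metis
qed

section \<open>Consequences of the axioms on \<open>D\<close>, \<open>Good\<close> and
  \<open>Appr\<close>\<close>

locale good_framework =
  approximations L K D Appr neg + metric_structures L K D d +
  isomorphism_notion L K D Appr Iso + good_vocabulary L K D Appr neg d Good
  for L :: "('f, 'r) vocabulary"
    and K :: "('f, 'r, 'a) struct set"
    and D :: "real set"
    and Appr :: "('f, 'r) atm \<Rightarrow> real \<Rightarrow> ('f, 'r) atm"
    and neg :: "('f, 'r) atm \<Rightarrow> ('f, 'r) atm"
    and d :: "('f, 'r, 'a) struct \<Rightarrow> 'a \<Rightarrow> 'a \<Rightarrow> real"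
    and Iso :: "real \<Rightarrow> ('f, 'r, 'a) struct \<Rightarrow> ('f, 'r, 'a) struct \<Rightarrow> ('a \<Rightarrow> 'a) \<Rightarrow> bool"
    and Good :: "nat \<Rightarrow> ('f, 'r) atm set"
begin

lemma D_between:
  assumes "0 \<le> x" "x < y"
  shows "\<exists>r\<in>D. x < r \<and> r < y"
proof -
  have "(x + y) / 2 \<in> closure D" using D_dense assms by auto
  moreover have "0 < (y - x) / 2" using assms by simp
  ultimately obtain r where "r \<in> D" "dist r ((x + y) / 2) < (y - x) / 2"
    unfolding closure_approachable by blast
  then show ?thesis by (intro bexI[of _ r]) (auto simp: dist_real_def abs_if field_simps split: if_splits)
qed

text \<open>Supplies error bounds for player I in the form that \<open>Good_Cauchy\<close>
  demands.\<close>

lemma ex_bounds_decreasing_to: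
  assumes "\<epsilon> \<in> D"
  shows "\<exists>e. (\<forall>n. e n \<in> D \<and> \<epsilon> < e n) \<and> decseq e \<and> e \<longlonglongrightarrow> \<epsilon>"
proof -
  have \<epsilon>: "0 \<le> \<epsilon>" using assms D_nonneg by auto
  have "\<exists>e. \<forall>n. (e n \<in> D \<and> \<epsilon> < e n \<and> e n < \<epsilon> + inverse (Suc n)) \<and> e (Suc n) \<le> e n"
  proof (rule dependent_nat_choice)
    show "\<exists>x. x \<in> D \<and> \<epsilon> < x \<and> x < \<epsilon> + inverse (Suc 0)"
      using D_between[OF \<epsilon>, of "\<epsilon> + inverse (Suc 0)"] by auto
    show "\<exists>y. (y \<in> D \<and> \<epsilon> < y \<and> y < \<epsilon> + inverse (Suc (Suc n))) \<and> y \<le> x"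
      if "x \<in> D \<and> \<epsilon> < x \<and> x < \<epsilon> + inverse (Suc n)" for x n
      using D_between[OF \<epsilon>, of "min x (\<epsilon> + inverse (Suc (Suc n)))"] that
      by (auto simp del: of_nat_Suc)
  qed
  then obtain e where e: "\<And>n. e n \<in> D" "\<And>n. \<epsilon> < e n" "\<And>n. e n < \<epsilon> + inverse (Suc n)"
    "\<And>n. e (Suc n) \<le> e n" by blast
  have "e \<longlonglongrightarrow> \<epsilon>"
  proof (rule tendsto_sandwich)
    show "(\<lambda>n. \<epsilon>) \<longlonglongrightarrow> \<epsilon>" by simp
    show "(\<lambda>n. \<epsilon> + inverse (Suc n)) \<longlonglongrightarrow> \<epsilon>"
      using tendsto_add[OF tendsto_const[of \<epsilon>] LIMSEQ_inverse_real_of_nat] by simp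
  qed (use e in \<open>auto intro!: always_eventually less_imp_le simp del: of_nat_Suc\<close>)
  then show ?thesis using e by (intro exI[of _ e]) (auto simp: decseq_Suc_iff)
qed

lemma Good_mono: "k \<le> l \<Longrightarrow> Good k \<subseteq> Good l"
  by (rule lift_Suc_mono_le[of Good]) (use Good_Suc in auto)

lemma Good_atom: "\<phi> \<in> Good k \<Longrightarrow> \<phi> \<in> atoms L"
  using Good_atoms by blast

lemma sat_Appr_Appr:
  assumes "\<phi> \<in> atoms L" "\<epsilon> \<in> D" "\<delta> \<in> D" "A \<in> K" "range s \<subseteq> univ A"
  shows "sat A s (Appr (Appr \<phi> \<epsilon>) \<delta>) \<longleftrightarrow> sat A s (Appr \<phi> (\<epsilon> + \<delta>))"
  using Appr_Appr assms by (simp add: equivalent_def)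

text \<open>Up to equivalence, \<open>Appr \<phi> \<delta>\<close> approximates
  \<open>Appr \<phi> \<epsilon>\<close> by the difference \<open>\<delta> - \<epsilon>\<close>,
  which lies in \<open>D\<close> by \<open>D_diff\<close>.\<close>

lemma sat_Appr_mono:
  assumes "\<phi> \<in> atoms L" "\<epsilon> \<in> D" "\<delta> \<in> D" "\<epsilon> \<le> \<delta>" "A \<in> K" "range s \<subseteq> univ A"
    and "sat A s (Appr \<phi> \<epsilon>)"
  shows "sat A s (Appr \<phi> \<delta>)"
proof -
  have \<delta>: "\<delta> - \<epsilon> \<in> D" using D_diff assms by simp
  have "sat A s (Appr (Appr \<phi> \<epsilon>) (\<delta> - \<epsilon>))"
    using entails_Appr[of "Appr \<phi> \<epsilon>" "\<delta> - \<epsilon>"] Appr_atom assms \<delta> by (auto simp: entails_def)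
  then show ?thesis using sat_Appr_Appr[of \<phi> \<epsilon> "\<delta> - \<epsilon>"] assms \<delta> by simp
qed

section \<open>From an isomorphism to a winning strategy\<close>

text \<open>Every round ends on the graph of \<open>f\<close>, so \<open>Iso_iff\<close> yields
  \<open>Appr \<phi> \<epsilon>\<close>, which weakens to \<open>Appr \<phi> (e k)\<close> because
  \<open>\<epsilon> < e k\<close>.\<close>

lemma II_wins_EF_of_Iso:
  assumes "Iso \<epsilon> A B f" "\<epsilon> \<in> D"
  shows "II_wins_EF D Appr Good \<epsilon> A (univ A) B (univ B)"
proof -
  have K: "A \<in> K" "B \<in> K" and bij: "bij_betw f (univ A) (univ B)" using Iso_bij assms by blast+
  define g where "g = inv_into (univ A) f"
  have surj: "f ` univ A = univ B" using bij by (simp add: bij_betw_def)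
  have g: "g v \<in> univ A" "f (g v) = v" if "v \<in> univ B" for v
    using that surj by (auto simp: g_def inv_into_into f_inv_into_f)
  have f: "f u \<in> univ B" if "u \<in> univ A" for u using that surj by blast
  \<comment> \<open>The history \<open>h\<close> contains the move to be answered as its last
    entry.\<close>
  define \<sigma> :: "(('a + 'a) \<times> real) list \<Rightarrow> 'a" where
    "\<sigma> h = (case fst (last h) of Inl u \<Rightarrow> f u | Inr v \<Rightarrow> g v)" for h
  have ans: "answer \<sigma> x e k = (case x k of Inl u \<Rightarrow> f u | Inr v \<Rightarrow> g v)" for x e k
    by (simp add: answer_def \<sigma>_def)
  have "winning_strategy D Appr Good \<epsilon> A (univ A) B (univ B) \<sigma>"
    unfolding winning_strategy_def
  proof (intro allI impI conjI)
    fix x :: "nat \<Rightarrow> 'a + 'a" and e :: "nat \<Rightarrow> real"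
    assume play: "\<forall>k. x k \<in> univ A <+> univ B \<and> e k \<in> D \<and> \<epsilon> < e k"
    then show "answer \<sigma> x e k \<in> (case x k of Inl _ \<Rightarrow> univ B | Inr _ \<Rightarrow> univ A)" for k
      using f g by (auto simp: ans dest!: spec[of _ k])
    let ?a = "left_elem x (answer \<sigma> x e)" and ?b = "right_elem x (answer \<sigma> x e)"
    have a: "?a k \<in> univ A" and b: "?b k = f (?a k)" for k
      using play[rule_format, of k] f g by (auto simp: ans left_elem_def right_elem_def)
    show "good_match Appr Good A B ?a ?b e"
      unfolding good_match_def
    proof (intro allI ballI impI)
      fix k \<phi> i
      assume \<phi>: "\<phi> \<in> Good k" and sat: "sat A (\<lambda>j. ?a (i j)) \<phi>"
      let ?s = "\<lambda>j. ?a (i j)"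
      have "range ?s \<subseteq> univ A" using a by auto
      then have "sat B (f \<circ> ?s) (Appr \<phi> \<epsilon>)"
        using Iso_iff[OF assms(2) K surj] assms(1) Good_atom[OF \<phi>] sat by blast
      then have "sat B (f \<circ> ?s) (Appr \<phi> (e k))"
        by (rule sat_Appr_mono[rotated -1])
          (use play assms(2) K a f Good_atom[OF \<phi>] in \<open>auto intro: less_imp_le\<close>)
      then show "sat B (\<lambda>j. ?b (i j)) (Appr \<phi> (e k))" by (simp add: b comp_def)
    qed
  qed
  then show ?thesis by (auto simp: II_wins_EF_def)
qed

section \<open>From a winning strategy to an isomorphism\<close>

text \<open>Truth is carried from \<open>s\<close> to \<open>t\<close> in three stages: inside
  \<open>A\<close> from \<open>s\<close> to nearby terms of \<open>a\<close>, across to the matching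
  terms of \<open>b\<close>, and inside \<open>B\<close> from these to \<open>t\<close>. The total
  error can be brought below \<open>\<epsilon> + \<delta>\<close> for each positive
  \<open>\<delta>\<close>.\<close>

lemma good_match_limit:
  assumes K: "A \<in> K" "B \<in> K" and \<epsilon>: "\<epsilon> \<in> D"
    and a: "range a \<subseteq> univ A" and b: "range b \<subseteq> univ B"
    and e: "\<And>n. e n \<in> D" "e \<longlonglongrightarrow> \<epsilon>"
    and match: "good_match Appr Good A B a b e"
    and s: "range s \<subseteq> univ A" and t: "range t \<subseteq> univ B"
    and cluster: "\<And>v. joint_cluster (d A) (d B) a b (s v) (t v)"
    and \<phi>: "\<phi> \<in> Good k" and sat: "sat A s \<phi>"
  shows "sat B t (Appr \<phi> \<epsilon>)"
proof -
  interpret A: Metric_space "univ A" "d A" by (rule metric[OF K(1)])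
  interpret B: Metric_space "univ B" "d B" by (rule metric[OF K(2)])
  have atom: "\<phi> \<in> atoms L" using \<phi> by (rule Good_atom)
  have "sat B t (Appr \<phi> (\<epsilon> + \<delta>))" if \<delta>: "\<delta> \<in> D" "0 < \<delta>" for \<delta>
  proof -
    \<comment> \<open>The stages cost \<open>\<eta>\<close>, \<open>e m\<close> and
      \<open>\<eta>\<close>; with \<open>e m < \<epsilon> + \<delta> / 3\<close> below, the sum is
      less than \<open>\<epsilon> + \<delta>\<close>.\<close>
    obtain \<eta> where \<eta>: "\<eta> \<in> D" "0 < \<eta>" "\<eta> < \<delta> / 3" using D_between[of 0 "\<delta> / 3"] \<delta> by auto
    \<comment> \<open>A level containing every approximation of \<open>\<phi>\<close> up to
      \<open>\<epsilon> + \<delta>\<close>. It depends on neither \<open>m\<close> nor the indices,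
      so the radius \<open>\<delta>2\<close> can be fixed before those are chosen.\<close>
    define N where "N = nat \<lceil>real k * exp (\<epsilon> + \<delta>)\<rceil>"
    have grow: "Appr \<phi> \<gamma> \<in> Good N" if "\<gamma> \<in> D" "\<gamma> \<le> \<epsilon> + \<delta>" for \<gamma>
    proof -
      have "nat \<lceil>real k * exp \<gamma>\<rceil> \<le> N"
        unfolding N_def by (intro nat_mono ceiling_mono mult_left_mono) (use that in auto)
      then show ?thesis using Good_Appr[OF \<phi> that(1)] Good_mono by blast
    qed
    obtain \<delta>1 where \<delta>1: "0 < \<delta>1" and contA: "\<And>\<psi> s t. \<psi> \<in> Good k \<Longrightarrow> range s \<subseteq> univ A \<Longrightarrow>
        range t \<subseteq> univ A \<Longrightarrow> (\<forall>v\<in>vars \<psi>. d A (s v) (t v) < \<delta>1) \<Longrightarrow> sat A s \<psi> \<Longrightarrow>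
        sat A t (Appr \<psi> \<eta>)"
      using Good_uniform[OF K(1) \<eta>(1,2), of k] by blast
    obtain \<delta>2 where \<delta>2: "0 < \<delta>2" and contB: "\<And>\<psi> s t. \<psi> \<in> Good N \<Longrightarrow> range s \<subseteq> univ B \<Longrightarrow>
        range t \<subseteq> univ B \<Longrightarrow> (\<forall>v\<in>vars \<psi>. d B (s v) (t v) < \<delta>2) \<Longrightarrow> sat B s \<psi> \<Longrightarrow>
        sat B t (Appr \<psi> \<eta>)"
      using Good_uniform[OF K(2) \<eta>(1,2), of N] by blast
    have "eventually (\<lambda>n. e n < \<epsilon> + \<delta> / 3) sequentially"
      using e(2) \<delta>(2) by (intro order_tendstoD) auto
    then obtain M where M: "\<And>n. M \<le> n \<Longrightarrow> e n < \<epsilon> + \<delta> / 3" by (auto simp: eventually_sequentially)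
    \<comment> \<open>\<open>m\<close> acts both as a round and as a level: \<open>M \<le> m\<close>
      makes \<open>e m\<close> small, and \<open>N \<le> m\<close> puts
      \<open>Appr \<phi> \<eta>\<close> into \<open>Good m\<close>. Each variable then receives an
      index at least \<open>m\<close>, as \<open>good_match\<close> requires at this level.\<close>
    define m where "m = max M N"
    have em: "e m < \<epsilon> + \<delta> / 3" by (rule M) (simp add: m_def)
    have "\<exists>n\<ge>m. d A (a n) (s v) < min \<delta>1 \<delta>2 \<and> d B (b n) (t v) < min \<delta>1 \<delta>2" for v
      using cluster[of v] \<delta>1 \<delta>2 unfolding joint_cluster_def by (meson min_less_iff_conj)
    then obtain i where i: "\<And>v. m \<le> i v" "\<And>v. d A (a (i v)) (s v) < \<delta>1"
        "\<And>v. d B (b (i v)) (t v) < \<delta>2"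
      by (metis min_less_iff_conj)
    have "range (\<lambda>v. a (i v)) \<subseteq> univ A" and bi: "range (\<lambda>v. b (i v)) \<subseteq> univ B" using a b by auto
    then have "sat A (\<lambda>v. a (i v)) (Appr \<phi> \<eta>)"
      by (intro contA[OF \<phi> s _ _ sat]) (use i(2) A.commute in auto)
    moreover have "0 \<le> \<epsilon>" using \<epsilon> D_nonneg by auto
    then have "Appr \<phi> \<eta> \<in> Good m"
      using grow[OF \<eta>(1)] \<eta> \<delta> Good_mono[of N m] by (auto simp: m_def)
    ultimately have "sat B (\<lambda>v. b (i v)) (Appr (Appr \<phi> \<eta>) (e m))"
      using match i(1) unfolding good_match_def by blast
    then have "sat B (\<lambda>v. b (i v)) (Appr \<phi> (\<eta> + e m))"
      using sat_Appr_Appr atom \<eta>(1) e(1) K(2) bi by blast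
    moreover have \<eta>m: "\<eta> + e m \<in> D" using D_add \<eta>(1) e(1) by blast
    moreover have "Appr \<phi> (\<eta> + e m) \<in> Good N" using grow[OF \<eta>m] \<eta> em by simp
    ultimately have "sat B t (Appr (Appr \<phi> (\<eta> + e m)) \<eta>)"
      by (intro contB[OF _ bi t]) (use i(3) in auto)
    then have "sat B t (Appr \<phi> (\<eta> + e m + \<eta>))"
      using sat_Appr_Appr atom \<eta>m \<eta>(1) K(2) t by blast
    then show ?thesis
      by (rule sat_Appr_mono[rotated -1]) (use atom \<eta> em D_add[OF \<eta>m \<eta>(1)] D_add[OF \<epsilon> \<delta>(1)] K t in auto)
  qed
  \<comment> \<open>Regrouped as approximations of \<open>Appr \<phi> \<epsilon>\<close>, so that
    \<open>sat_iff_Appr\<close> removes the positive \<open>\<delta>\<close>.\<close>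
  then have "\<forall>\<delta> \<in> D - {0}. sat B t (Appr (Appr \<phi> \<epsilon>) \<delta>)"
    using sat_Appr_Appr[OF atom \<epsilon> _ K(2) t] D_nonneg by (fastforce simp: order_less_le)
  then show ?thesis using sat_iff_Appr[OF Appr_atom[OF atom \<epsilon>] K(2) t] by blast
qed

text \<open>Existence of joint cluster points from the side of \<open>A\<close> gives
  \<open>f\<close>, and from the side of \<open>B\<close> gives preimages. Surjectivity suffices for
  \<open>Iso_iff\<close>; injectivity of \<open>f\<close> then comes with
  \<open>Iso_bij\<close>.\<close>

lemma Iso_of_dense_good_match:
  assumes K: "A \<in> K" "B \<in> K" and \<epsilon>: "\<epsilon> \<in> D"
    and a: "range a \<subseteq> univ A" and b: "range b \<subseteq> univ B"
    and e: "\<And>n. e n \<in> D \<and> \<epsilon> < e n" "decseq e" "e \<longlonglongrightarrow> \<epsilon>"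
    and match: "good_match Appr Good A B a b e"
    and freqA: "\<And>x r N. x \<in> univ A \<Longrightarrow> 0 < r \<Longrightarrow> \<exists>n\<ge>N. d A (a n) x < r"
    and freqB: "\<And>y r N. y \<in> univ B \<Longrightarrow> 0 < r \<Longrightarrow> \<exists>n\<ge>N. d B (b n) y < r"
  shows "\<exists>f. Iso \<epsilon> A B f"
proof -
  note MA = metric[OF K(1)] and MB = metric[OF K(2)]
  have Cauchy: "Metric_space.MCauchy (univ A) (d A) (a \<circ> i) \<longleftrightarrow>
      Metric_space.MCauchy (univ B) (d B) (b \<circ> i)" if "strict_mono i" for i
    by (rule Good_Cauchy[where e = e, OF K \<epsilon> a b]) (fact e match that)+
  have "\<exists>y \<in> univ B. joint_cluster (d A) (d B) a b x y" if "x \<in> univ A" for x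
    by (rule joint_cluster_exists[OF MA MB complete[OF K(2)] a])
      (use Cauchy freqA that in auto)
  then obtain f where f: "\<And>x. x \<in> univ A \<Longrightarrow> f x \<in> univ B"
    "\<And>x. x \<in> univ A \<Longrightarrow> joint_cluster (d A) (d B) a b x (f x)" by metis
  have surj: "f ` univ A = univ B"
  proof
    show "univ B \<subseteq> f ` univ A"
    proof
      fix y assume y: "y \<in> univ B"
      have "\<exists>x \<in> univ A. joint_cluster (d B) (d A) b a y x"
        by (rule joint_cluster_exists[OF MB MA complete[OF K(1)] b])
          (use Cauchy freqB y in auto)
      then obtain x where x: "x \<in> univ A" "joint_cluster (d A) (d B) a b x y"
        using joint_cluster_commute by metis
      \<comment> \<open>\<open>f x\<close> was merely some partner of \<open>x\<close>; uniqueness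
        identifies it with the partner \<open>y\<close>.\<close>
      have "f x = y"
        by (rule joint_cluster_unique[OF MA MB a b _ x(1) _ y f(2)[OF x(1)] x(2)])
          (use Cauchy f x in auto)
      then show "y \<in> f ` univ A" using x by blast
    qed
  qed (use f in auto)
  have "sat B (f \<circ> s) (Appr \<phi> \<epsilon>)"
    if \<phi>: "\<phi> \<in> atoms L" and s: "range s \<subseteq> univ A" and sat: "sat A s \<phi>" for \<phi> s
  proof -
    \<comment> \<open>The equivalence is used at \<open>0\<close> to pass from \<open>\<phi>\<close>
      to \<open>\<psi>\<close> in \<open>A\<close>, and at \<open>\<epsilon>\<close> to return in
      \<open>B\<close>.\<close>
    obtain k \<psi> where \<psi>: "\<psi> \<in> Good k" and
      eq: "\<And>\<delta>. \<delta> \<in> D \<Longrightarrow> equivalent K (Appr \<phi> \<delta>) (Appr \<psi> \<delta>)" using Good_cover[OF \<phi>] by blast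
    have "sat A s \<psi>"
      using sat eq[OF D_zero] Appr_zero[OF \<phi>] Appr_zero[OF Good_atom[OF \<psi>]] K(1) s
      unfolding equivalent_def by blast
    moreover have t: "range (f \<circ> s) \<subseteq> univ B" using s f(1) by auto
    ultimately have "sat B (f \<circ> s) (Appr \<psi> \<epsilon>)"
      by (intro good_match_limit[OF K \<epsilon> a b _ e(3) match s t _ \<psi>]) (use e(1) s f(2) in \<open>auto simp: image_subset_iff\<close>)
    then show ?thesis using eq[OF \<epsilon>] K(2) t unfolding equivalent_def by blast
  qed
  then show ?thesis using Iso_iff[OF \<epsilon> K surj] by blast
qed

lemma Iso_of_II_wins_EF:
  assumes K: "A \<in> K" "B \<in> K" and \<epsilon>: "\<epsilon> \<in> D"
    and sepA: "separable_space (Metric_space.mtopology (univ A) (d A))"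
    and sepB: "separable_space (Metric_space.mtopology (univ B) (d B))"
    and win: "II_wins_EF D Appr Good \<epsilon> A (univ A) B (univ B)"
  shows "\<exists>f. Iso \<epsilon> A B f"
proof -
  interpret A: Metric_space "univ A" "d A" by (rule metric[OF K(1)])
  interpret B: Metric_space "univ B" "d B" by (rule metric[OF K(2)])
  obtain P where P: "countable P" "P \<subseteq> univ A" "A.mtopology closure_of P = univ A"
    using sepA by (auto simp: separable_space_def)
  obtain Q where Q: "countable Q" "Q \<subseteq> univ B" "B.mtopology closure_of Q = univ B"
    using sepB by (auto simp: separable_space_def)
  \<comment> \<open>The closure of \<open>P\<close> is the universe, which is nonempty, whereas the
    empty set has empty closure.\<close>
  have "P \<noteq> {}" using P(3) structs[OF K(1)] by (auto simp: is_struct_def)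
  then have "countable (P <+> Q)" "P <+> Q \<noteq> {}" using P(1) Q(1) by auto
  then obtain x where x: "range x = P <+> Q" "\<And>s N. s \<in> P <+> Q \<Longrightarrow> \<exists>n\<ge>N. x (n::nat) = s"
    by (rule enumeration_infinitely_often) blast
  obtain e where e: "\<And>n. e n \<in> D \<and> \<epsilon> < e n" "decseq e" "e \<longlonglongrightarrow> \<epsilon>"
    using ex_bounds_decreasing_to[OF \<epsilon>] by blast
  obtain \<sigma> where \<sigma>: "winning_strategy D Appr Good \<epsilon> A (univ A) B (univ B) \<sigma>"
    using win by (auto simp: II_wins_EF_def)
  define a where "a = left_elem x (answer \<sigma> x e)"
  define b where "b = right_elem x (answer \<sigma> x e)"
  have xk: "x k \<in> univ A <+> univ B" for k
    using rangeI[of x k] P(2) Q(2) unfolding x(1) by auto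
  then have ans: "\<And>k. answer \<sigma> x e k \<in> (case x k of Inl _ \<Rightarrow> univ B | Inr _ \<Rightarrow> univ A)"
    and match: "good_match Appr Good A B a b e"
    using \<sigma>[unfolded winning_strategy_def, rule_format, of x e] e(1) unfolding a_def b_def by auto
  have "a k \<in> univ A \<and> b k \<in> univ B" for k
    using xk[of k] ans[of k] by (auto simp: a_def b_def left_elem_def right_elem_def)
  then have ab: "range a \<subseteq> univ A" "range b \<subseteq> univ B" by auto
  \<comment> \<open>In a round where player I picks \<open>Inl p\<close>, the left element is
    \<open>p\<close> itself. The answers of player II enter \<open>a\<close> only in rounds tagged
    \<open>Inr\<close>.\<close>
  have a: "\<exists>n\<ge>N. a n = p" if "p \<in> P" for p N
  proof -
    obtain n where "N \<le> n" "x n = Inl p" using x(2)[OF InlI[OF \<open>p \<in> P\<close>]] by blast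
    then show ?thesis by (intro exI[of _ n]) (simp add: a_def left_elem_def)
  qed
  have b: "\<exists>n\<ge>N. b n = q" if "q \<in> Q" for q N
  proof -
    obtain n where "N \<le> n" "x n = Inr q" using x(2)[OF InrI[OF \<open>q \<in> Q\<close>]] by blast
    then show ?thesis by (intro exI[of _ n]) (simp add: b_def right_elem_def)
  qed
  show ?thesis
  proof (rule Iso_of_dense_good_match[OF K \<epsilon> ab e match])
    show "\<exists>n\<ge>N. d A (a n) u < r" if "u \<in> univ A" "0 < r" for u r N
      using A.frequently_near[OF P(2,3) that(1) a that(2)] .
    show "\<exists>n\<ge>N. d B (b n) v < r" if "v \<in> univ B" "0 < r" for v r N
      using B.frequently_near[OF Q(2,3) that(1) b that(2)] .
  qed
qed

end

theorem theorem4p11: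
  fixes L :: "('f, 'r) vocabulary"
    and K :: "('f, 'r, 'a) struct set"
    and D :: "real set"
    and Appr :: "('f, 'r) atm \<Rightarrow> real \<Rightarrow> ('f, 'r) atm"
    and neg :: "('f, 'r) atm \<Rightarrow> ('f, 'r) atm"
    and d :: "('f, 'r, 'a) struct \<Rightarrow> 'a \<Rightarrow> 'a \<Rightarrow> real"
    and Iso :: "real \<Rightarrow> ('f, 'r, 'a) struct \<Rightarrow> ('f, 'r, 'a) struct \<Rightarrow> ('a \<Rightarrow> 'a) \<Rightarrow> bool"
    and Good :: "nat \<Rightarrow> ('f, 'r) atm set"
    and A B :: "('f, 'r, 'a) struct"
    and \<epsilon> :: real
  assumes "approximations L K D Appr neg"
    and "metric_structures L K D d"
    and "isomorphism_notion L K D Appr Iso"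
    and "good_vocabulary L K D Appr neg d Good"
    and "A \<in> K" and "B \<in> K"
    and "separable_space (Metric_space.mtopology (univ A) (d A))"
    and "separable_space (Metric_space.mtopology (univ B) (d B))"
    and "\<epsilon> \<in> D"
  shows "II_wins_EF D Appr Good \<epsilon> A (univ A) B (univ B) \<longleftrightarrow> (\<exists>f. Iso \<epsilon> A B f)"
proof -
  interpret good_framework L K D Appr neg d Iso Good
    using assms(1-4) by (rule good_framework.intro)
  show ?thesis using Iso_of_II_wins_EF II_wins_EF_of_Iso assms(5-9) by blast
qed

end
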